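(* Let $C_1, C_2 \in \mathbb{C}$, let $R_1, R_2$ be the roots of the polynomial equation $z^2 + C_1 z + C_2 = 0$, and let $P_1 = -C_1/2$. If a line $\ell_1 \subset \mathbb{C}\setminus\{0\}$ (that is, a line in the complex plane not passing through $0$) contains the roots $R_1, R_2$, and $R_1 \neq R_2$, then $$\angle\, 0\,P_1\,R_1 = \angle\, R_1\,P_1\,(C_2/P_1),$$ where $R_1$, without loss of generality, represents either of the two roots of the equation.
   Context: Complex numbers are identified with points of the plane. A line in $\mathbb{C}$ is a set of the form $\{p + tv : t \in \mathbb{R}\}$ with $p, v \in \mathbb{C}$ fixed, $v\neq 0$. For points $A, B, C \in \mathbb{C}$ with $A \neq B$ and $C \neq B$, $\angle ABC$ denotes the angle at the vertex $B$ formed by the line segments $\overline{BA}$ and $\overline{BC}$. The point $P_1 = -C_1/2 = (R_1+R_2)/2$ is the midpoint of the segment $\overline{R_1R_2}$, hence lies on $\ell_1$ (so $P_1 \neq 0$), and $C_2 = R_1R_2$. *)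

theory Defs
  imports "HOL-Analysis.Analysis"
begin

definition is_line :: "complex set \<Rightarrow> bool" where
  "is_line L \<longleftrightarrow> (\<exists>p v. v \<noteq> 0 \<and> L = {p + of_real t * v | t :: real. True})"

text \<open>
  The undirected angle, in the interval from 0 to pi, at the vertex \<open>B\<close> between the segments from
  \<open>B\<close> to \<open>A\<close> and from \<open>B\<close> to \<open>C\<close>; the inner product on the complex numbers is the real one of the
  plane. The value is meaningful only for \<open>A \<noteq> B\<close> and \<open>C \<noteq> B\<close> (otherwise it is pi/2, since
  division by zero yields zero).
\<close>

definition angle :: "complex \<Rightarrow> complex \<Rightarrow> complex \<Rightarrow> real" where
  "angle A B C = arccos (((A - B) \<bullet> (C - B)) / (norm (A - B) * norm (C - B)))"

end

theory Submission
  imports Defs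
begin

text \<open>
  Completing the square, a root \<open>R\<close> satisfies \<open>(R - P1)\<^sup>2 = P1\<^sup>2 - C2\<close>, that is,
  \<open>(0 - P1) * (C2 / P1 - P1) = (R - P1)\<^sup>2\<close>: the vector from \<open>P1\<close> to \<open>R\<close> is the geometric mean of
  the vectors from \<open>P1\<close> to \<open>0\<close> and to \<open>C2 / P1\<close>. Hence the spiral similarity about \<open>P1\<close>
  with complex ratio \<open>(R - P1) / (0 - P1)\<close> maps \<open>0\<close> to \<open>R\<close> and \<open>R\<close> to \<open>C2 / P1\<close>, and it
  preserves angles (\<open>angle_spiral_similarity\<close>). The line enters because, being convex, it
  contains the midpoint \<open>P1\<close> of its points \<open>R1\<close> and \<open>R2\<close>; as it avoids \<open>0\<close>, the ratio has a
  nonzero denominator. The numerator is nonzero because the roots are distinct.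
\<close>

lemma inner_mult_left_complex:
  fixes k u v :: complex
  shows "(k * u) \<bullet> (k * v) = (norm k)\<^sup>2 * (u \<bullet> v)"
  unfolding cmod_power2 inner_complex_def by (simp add: power2_eq_square algebra_simps)

text \<open>
  Multiplication by \<open>k\<close> scales the inner product and the product of the norms by the same
  factor \<open>(norm k)\<^sup>2\<close>, so the cosine of the angle does not change.
\<close>

lemma angle_spiral_similarity:
  assumes "k \<noteq> 0"
  shows "angle (B + k * (A - B)) B (B + k * (C - B)) = angle A B C"
proof -
  have "(norm k)\<^sup>2 * ((A - B) \<bullet> (C - B)) / ((norm k)\<^sup>2 * (norm (A - B) * norm (C - B)))
      = ((A - B) \<bullet> (C - B)) / (norm (A - B) * norm (C - B))"
    using assms by simp
  then show ?thesis
    by (simp add: angle_def inner_mult_left_complex norm_mult power2_eq_square mult.assoc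
        mult.left_commute)
qed

lemma midpoint_in_line:
  assumes "is_line L" "a \<in> L" "b \<in> L"
  shows "(a + b) / 2 \<in> L"
proof -
  obtain p v where L: "L = {p + of_real t * v | t :: real. True}"
    using assms(1) unfolding is_line_def by blast
  obtain s t where "a = p + of_real s * v" "b = p + of_real t * v"
    using assms(2,3) L by blast
  then have "(a + b) / 2 = p + of_real ((s + t) / 2) * v"
    by (simp add: field_simps)
  then show ?thesis
    using L by blast
qed

theorem proposition2p1:
  fixes C1 C2 R1 R2 P1 :: complex and l1 :: "complex set"
  assumes roots: "{z. z\<^sup>2 + C1 * z + C2 = 0} = {R1, R2}"
    and P1: "P1 = - C1 / 2"
    and line: "is_line l1" "0 \<notin> l1" "R1 \<in> l1" "R2 \<in> l1"
    and distinct: "R1 \<noteq> R2"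
  shows "\<forall>R\<in>{R1, R2}. angle 0 P1 R = angle R P1 (C2 / P1)"
proof
  fix R assume R: "R \<in> {R1, R2}"
  have root: "z\<^sup>2 + C1 * z + C2 = 0" if "z \<in> {R1, R2}" for z
    using that roots by blast
  have "(R1 - R2) * (R1 + R2 + C1) = (R1\<^sup>2 + C1 * R1 + C2) - (R2\<^sup>2 + C1 * R2 + C2)"
    by (simp add: power2_eq_square algebra_simps)
  also have "\<dots> = 0"
    using root by simp
  finally have "R1 + R2 + C1 = 0"
    using distinct by simp
  then have "C1 = - (R1 + R2)"
    by (metis add.commute eq_neg_iff_add_eq_0)
  then have mid: "P1 = (R1 + R2) / 2"
    using P1 by simp
  have "P1 \<noteq> 0"
    using midpoint_in_line[OF line(1,3,4)] line(2) mid by auto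
  have "R \<noteq> P1"
    using R mid distinct by (auto simp: field_simps)
  define k where "k = (R - P1) / (0 - P1)"
  have "k \<noteq> 0"
    using \<open>R \<noteq> P1\<close> \<open>P1 \<noteq> 0\<close> by (simp add: k_def)
  have zero_to_R: "P1 + k * (0 - P1) = R"
    using \<open>P1 \<noteq> 0\<close> by (simp add: k_def)
  have "C1 = - 2 * P1"
    using P1 by simp
  then have "C2 = 2 * P1 * R - R\<^sup>2"
    using root[OF R] by algebra
  then have R_to_quotient: "P1 + k * (R - P1) = C2 / P1"
    using \<open>P1 \<noteq> 0\<close> by (simp add: k_def field_simps power2_eq_square)
  show "angle 0 P1 R = angle R P1 (C2 / P1)"
    using angle_spiral_similarity[OF \<open>k \<noteq> 0\<close>, of P1 0 R]
    unfolding zero_to_R R_to_quotient by simp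
qed

end
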